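(* Let $X$ be a nonempty set, let $d\in\mathbb{N}$, and let $\mathbf{K}:X\times X\to\mathbb{R}^{d\times d}$ be an admissible multi-task kernel. Assume that for all $m\in\mathbb{N}$, all pairwise distinct $x_1,\dots,x_m\in X$ and all $\boldsymbol{y}\in\mathbb{R}^{md}$ the minimal norm interpolation problem $\min_{f\in\mathcal{I}_{\mathbf{x}}(\boldsymbol{y})}\|f\|_{\mathcal{B}_{\mathbf{K}}}$ has a minimizer. Then $\mathcal{B}_{\mathbf{K}}$ satisfies the linear representer theorem for minimal norm interpolation if and only if for all $m\in\mathbb{N}$ and all pairwise distinct points $\mathbf{x}=\{x_j:j\in\mathbb{N}_m\}\subseteq X$, $$\sup_{t\in X}\|\mathbf{K}[\mathbf{x}]^{-1}\mathbf{K}_{\mathbf{x}}(t)\|_1\le1.$$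
   Context: $\mathbb{N}=\{1,2,\dots\}$ and $\mathbb{N}_m=\{1,\dots,m\}$. For a vector, $\|\cdot\|_p$ is the $\ell^p$ norm; for a matrix, $\|\cdot\|_p$ is the $\ell^p$-induced operator norm. For a nonempty set $\Omega$, $\ell^1_d(\Omega)=\{\boldsymbol{c}=(\boldsymbol{c}_t\in\mathbb{R}^d:t\in\Omega): \|\boldsymbol{c}\|_{\ell^1_d(\Omega)}=\sum_{t\in\Omega}\|\boldsymbol{c}_t\|_1<\infty\}$, and $\mathrm{supp}\,\boldsymbol{c}=\{t:\boldsymbol{c}_t\ne0\}$. For points $\mathbf{x}=\{x_1,\dots,x_m\}$, $\mathbf{K}[\mathbf{x}]\in\mathbb{R}^{md\times md}$ is the block matrix whose $(j,k)$ block is $\mathbf{K}(x_k,x_j)$, and for $t\in X$, $\mathbf{K}_{\mathbf{x}}(t)=(\mathbf{K}(t,x_j):j\in\mathbb{N}_m)^\top\in\mathbb{R}^{md\times d}$ is the block column whose $j$-th block is $\mathbf{K}(t,x_j)$. Admissible multi-task kernel: a function $\mathbf{K}:X\times X\to\mathbb{R}^{d\times d}$ with $\mathbf{K}(x,x')^\top=\mathbf{K}(x,x')$ for all $x,x'\in X$ such that (A1) $\mathbf{K}[\mathbf{x}]$ is non-singular for all finite sets $\mathbf{x}$ of pairwise distinct points of $X$; (A2) there is $\kappa>0$ with $\|\mathbf{K}(x,x')\|_1\le\kappa$ for all $x,x'\in X$; (A3) for all pairwise distinct $x_j\in X$, $j\in\mathbb{N}$, and $(\boldsymbol{c}_j)_{j\in\mathbb{N}}\in\ell^1_d(\mathbb{N})$,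 if $\sum_{j\in\mathbb{N}}\mathbf{K}(x_j,x)\boldsymbol{c}_j=0$ for all $x\in X$, then $\boldsymbol{c}_j=0$ for all $j$. The space $\mathcal{B}_{\mathbf{K}}=\{\sum_{x\in\mathrm{supp}\,\boldsymbol{c}}\mathbf{K}(x,\cdot)\boldsymbol{c}_x:\boldsymbol{c}\in\ell^1_d(X)\}$ carries the norm $\|\sum_{x\in\mathrm{supp}\,\boldsymbol{c}}\mathbf{K}(x,\cdot)\boldsymbol{c}_x\|_{\mathcal{B}_{\mathbf{K}}}=\|\boldsymbol{c}\|_{\ell^1_d(X)}$. For $\boldsymbol{y}=(\boldsymbol{y}_1,\dots,\boldsymbol{y}_m)\in\mathbb{R}^{md}$, $\mathcal{I}_{\mathbf{x}}(\boldsymbol{y})=\{f\in\mathcal{B}_{\mathbf{K}}: f(x_j)=\boldsymbol{y}_j,\ j\in\mathbb{N}_m\}$, and $\mathcal{S}^{\mathbf{x}}=\{\sum_{j=1}^m\mathbf{K}(x_j,\cdot)\boldsymbol{c}_j:\boldsymbol{c}_j\in\mathbb{R}^d\}$. $\mathcal{B}_{\mathbf{K}}$ satisfies the linear representer theorem for minimal norm interpolation if for every $m\in\mathbb{N}$ and every choice of sampling data $\{(x_j,\boldsymbol{y}_j):j\in\mathbb{N}_m\}\subseteq X\times\mathbb{R}^d$ with pairwise distinct $x_j$, the problem $\min_{f\in\mathcal{I}_{\mathbf{x}}(\boldsymbol{y})}\|f\|_{\mathcal{B}_{\mathbf{K}}}$ has a minimizer belonging to $\mathcal{S}^{\mathbf{x}}$.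 *)

theory Defs
  imports
    "HOL-Library.Extended_Real"
    "HOL-Analysis.Infinite_Sum"
    "Jordan_Normal_Form.Gauss_Jordan_Elimination"
begin

text \<open>
  Vectors and matrices are those of \<open>Jordan_Normal_Form\<close>, because the size \<open>m * d\<close> of the block
  matrices varies inside the statements. Points and blocks are indexed by \<open>j < m\<close>, so that block
  number \<open>j\<close> of a vector or matrix occupies the indices \<open>j * d, \<dots>, j * d + d - 1\<close>. A function on \<open>X\<close>
  is extensional, i.e. \<open>undefined\<close> outside \<open>X\<close>, so that equality of functions means equality on \<open>X\<close>.
\<close>

definition vec_norm1 :: "real vec \<Rightarrow> real" where
  "vec_norm1 v = (\<Sum>i<dim_vec v. \<bar>v $ i\<bar>)"

definition mat_norm1 :: "real mat \<Rightarrow> real" where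
  "mat_norm1 A = Sup {vec_norm1 (A *\<^sub>v v) | v. v \<in> carrier_vec (dim_col A) \<and> vec_norm1 v \<le> 1}"

definition l1_space :: "nat \<Rightarrow> 't set \<Rightarrow> ('t \<Rightarrow> real vec) set" where
  "l1_space d \<Omega> = {c \<in> \<Omega> \<rightarrow>\<^sub>E carrier_vec d. (\<lambda>t. vec_norm1 (c t)) summable_on \<Omega>}"

definition l1_norm :: "'t set \<Rightarrow> ('t \<Rightarrow> real vec) \<Rightarrow> real" where
  "l1_norm \<Omega> c = (\<Sum>\<^sub>\<infinity>t\<in>\<Omega>. vec_norm1 (c t))"

definition l1_supp :: "nat \<Rightarrow> 't set \<Rightarrow> ('t \<Rightarrow> real vec) \<Rightarrow> 't set" where
  "l1_supp d \<Omega> c = {t \<in> \<Omega>. c t \<noteq> 0\<^sub>v d}"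

text \<open>
  The type of vectors of varying dimension carries no topology, so series in \<open>\<real>\<^sup>d\<close> are summed
  componentwise. The series used below converge absolutely by the boundedness condition on the
  kernel.
\<close>
definition vec_infsum :: "nat \<Rightarrow> ('t \<Rightarrow> real vec) \<Rightarrow> 't set \<Rightarrow> real vec" where
  "vec_infsum d f A = vec d (\<lambda>i. \<Sum>\<^sub>\<infinity>t\<in>A. f t $ i)"

definition distinct_points :: "'a set \<Rightarrow> nat \<Rightarrow> (nat \<Rightarrow> 'a) \<Rightarrow> bool" where
  "distinct_points X m x \<longleftrightarrow> x ` {..<m} \<subseteq> X \<and> inj_on x {..<m}"

text \<open>Block \<open>(j, k)\<close> of the kernel matrix is \<open>K (x k) (x j)\<close>, in this order of the arguments.\<close>
definition kernel_matrix ::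
    "nat \<Rightarrow> ('a \<Rightarrow> 'a \<Rightarrow> real mat) \<Rightarrow> nat \<Rightarrow> (nat \<Rightarrow> 'a) \<Rightarrow> real mat" where
  "kernel_matrix d K m x =
     mat (m * d) (m * d) (\<lambda>(p, q). K (x (q div d)) (x (p div d)) $$ (p mod d, q mod d))"

definition kernel_column ::
    "nat \<Rightarrow> ('a \<Rightarrow> 'a \<Rightarrow> real mat) \<Rightarrow> nat \<Rightarrow> (nat \<Rightarrow> 'a) \<Rightarrow> 'a \<Rightarrow> real mat" where
  "kernel_column d K m x t =
     mat (m * d) d (\<lambda>(p, q). K t (x (p div d)) $$ (p mod d, q))"

definition admissible_kernel :: "'a set \<Rightarrow> nat \<Rightarrow> ('a \<Rightarrow> 'a \<Rightarrow> real mat) \<Rightarrow> bool" where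
  "admissible_kernel X d K \<longleftrightarrow>
     (\<forall>s\<in>X. \<forall>t\<in>X. K s t \<in> carrier_mat d d \<and> transpose_mat (K s t) = K s t) \<and>
     (\<forall>m>0. \<forall>x. distinct_points X m x \<longrightarrow> invertible_mat (kernel_matrix d K m x)) \<and>
     (\<exists>\<kappa>>0. \<forall>s\<in>X. \<forall>t\<in>X. mat_norm1 (K s t) \<le> \<kappa>) \<and>
     (\<forall>(x :: nat \<Rightarrow> 'a) c. range x \<subseteq> X \<and> inj x \<and> c \<in> l1_space d UNIV \<and>
        (\<forall>s\<in>X. vec_infsum d (\<lambda>j. K (x j) s *\<^sub>v c j) UNIV = 0\<^sub>v d) \<longrightarrow>
        (\<forall>j. c j = 0\<^sub>v d))"

definition kernel_series ::
    "'a set \<Rightarrow> nat \<Rightarrow> ('a \<Rightarrow> 'a \<Rightarrow> real mat) \<Rightarrow> ('a \<Rightarrow> real vec) \<Rightarrow> 'a \<Rightarrow> real vec" where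
  "kernel_series X d K c = (\<lambda>s\<in>X. vec_infsum d (\<lambda>t. K t s *\<^sub>v c t) (l1_supp d X c))"

definition B_space :: "'a set \<Rightarrow> nat \<Rightarrow> ('a \<Rightarrow> 'a \<Rightarrow> real mat) \<Rightarrow> ('a \<Rightarrow> real vec) set" where
  "B_space X d K = kernel_series X d K ` l1_space d X"

text \<open>For an admissible kernel the coefficients of an element of the space are unique.\<close>
definition B_norm ::
    "'a set \<Rightarrow> nat \<Rightarrow> ('a \<Rightarrow> 'a \<Rightarrow> real mat) \<Rightarrow> ('a \<Rightarrow> real vec) \<Rightarrow> real" where
  "B_norm X d K f = (THE r. \<exists>c\<in>l1_space d X. f = kernel_series X d K c \<and> r = l1_norm X c)"

text \<open>The data vector in \<open>\<real>\<^sup>m\<^sup>d\<close> is given by its blocks \<open>y j\<close>, \<open>j < m\<close>.\<close>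
definition interpolants ::
    "'a set \<Rightarrow> nat \<Rightarrow> ('a \<Rightarrow> 'a \<Rightarrow> real mat) \<Rightarrow> nat \<Rightarrow> (nat \<Rightarrow> 'a) \<Rightarrow> (nat \<Rightarrow> real vec) \<Rightarrow>
      ('a \<Rightarrow> real vec) set" where
  "interpolants X d K m x y = {f \<in> B_space X d K. \<forall>j<m. f (x j) = y j}"

definition kernel_span ::
    "'a set \<Rightarrow> nat \<Rightarrow> ('a \<Rightarrow> 'a \<Rightarrow> real mat) \<Rightarrow> nat \<Rightarrow> (nat \<Rightarrow> 'a) \<Rightarrow> ('a \<Rightarrow> real vec) set" where
  "kernel_span X d K m x =
     {(\<lambda>s\<in>X. finsum_vec TYPE(real) d (\<lambda>j. K (x j) s *\<^sub>v c j) {..<m}) | c.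
        \<forall>j<m. c j \<in> carrier_vec d}"

definition min_norm_interpolant ::
    "'a set \<Rightarrow> nat \<Rightarrow> ('a \<Rightarrow> 'a \<Rightarrow> real mat) \<Rightarrow> nat \<Rightarrow> (nat \<Rightarrow> 'a) \<Rightarrow> (nat \<Rightarrow> real vec) \<Rightarrow>
      ('a \<Rightarrow> real vec) \<Rightarrow> bool" where
  "min_norm_interpolant X d K m x y f \<longleftrightarrow>
     is_arg_min (B_norm X d K) (\<lambda>g. g \<in> interpolants X d K m x y) f"

definition linear_representer_theorem :: "'a set \<Rightarrow> nat \<Rightarrow> ('a \<Rightarrow> 'a \<Rightarrow> real mat) \<Rightarrow> bool" where
  "linear_representer_theorem X d K \<longleftrightarrow>
     (\<forall>m>0. \<forall>x y. distinct_points X m x \<and> (\<forall>j<m. y j \<in> carrier_vec d) \<longrightarrow>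
        (\<exists>f\<in>kernel_span X d K m x. min_norm_interpolant X d K m x y f))"

end

theory Submission
  imports Defs
begin

text \<open>
  An admissible kernel determines the coefficients of an element of the space: condition (A1) treats
  finitely supported coefficients and (A3) the countably infinite supports, so the norm of a kernel
  series is the \<open>\<ell>\<^sup>1\<close> norm of its coefficients. By (A1) the span contains exactly one interpolant of
  data \<open>y\<close>, and its norm is that of \<open>K[x]\<^sup>-\<^sup>1 y\<close>. Testing the representer theorem on the data sampled from
  \<open>K(t, \<cdot>) b\<close>, whose norm is that of \<open>b\<close>, bounds \<open>K[x]\<^sup>-\<^sup>1 K\<^sub>x(t) b\<close>. Conversely, for any interpolant with
  coefficients \<open>c\<close>, interchanging \<open>K[x]\<^sup>-\<^sup>1\<close> with the kernel series writes \<open>K[x]\<^sup>-\<^sup>1 y\<close> as the series of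
  the \<open>K[x]\<^sup>-\<^sup>1 K\<^sub>x(t) c\<^sub>t\<close>, whose terms are at most the norm of \<open>c\<^sub>t\<close>.
\<close>

section \<open>The \<open>\<ell>\<^sup>1\<close> norm of vectors and matrices\<close>

lemma vec_norm1_nonneg: "vec_norm1 v \<ge> 0"
  unfolding vec_norm1_def by (simp add: sum_nonneg)

lemma vec_norm1_zero [simp]: "vec_norm1 (0\<^sub>v n) = 0"
  unfolding vec_norm1_def by simp

lemma abs_index_le_vec_norm1: "i < dim_vec v \<Longrightarrow> \<bar>v $ i\<bar> \<le> vec_norm1 v"
  unfolding vec_norm1_def by (rule member_le_sum) auto

lemma vec_norm1_eq_0D: "vec_norm1 v = 0 \<Longrightarrow> v \<in> carrier_vec n \<Longrightarrow> v = 0\<^sub>v n"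
  using abs_index_le_vec_norm1[of _ v] by (intro eq_vecI) force+

lemma vec_norm1_smult: "vec_norm1 (a \<cdot>\<^sub>v v) = \<bar>a\<bar> * vec_norm1 v"
  unfolding vec_norm1_def by (simp add: sum_distrib_left abs_mult)

lemma vec_norm1_diff_le:
  assumes "u \<in> carrier_vec n" "v \<in> carrier_vec n"
  shows "vec_norm1 (u - v) \<le> vec_norm1 u + vec_norm1 v"
proof -
  have "(\<Sum>i<n. \<bar>u $ i - v $ i\<bar>) \<le> (\<Sum>i<n. \<bar>u $ i\<bar> + \<bar>v $ i\<bar>)"
    by (intro sum_mono abs_triangle_ineq4)
  then show ?thesis
    using assms by (simp add: vec_norm1_def sum.distrib)
qed

text \<open>By homogeneity this reduces to the rescaled vector of norm one, which is among those
  over which \<open>mat_norm1\<close> takes its supremum.\<close>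

lemma vec_norm1_mult_mat_vec_le:
  assumes v: "v \<in> carrier_vec (dim_col A)"
  shows "vec_norm1 (A *\<^sub>v v) \<le> mat_norm1 A * vec_norm1 v"
proof -
  \<comment> \<open>A crude bound for the operator: it shows that the set under the real supremum is
    bounded above, and it settles the case of norm zero, where rescaling is impossible.\<close>
  define C where "C = (\<Sum>i<dim_row A. \<Sum>j<dim_col A. \<bar>A $$ (i, j)\<bar>)"
  have C: "vec_norm1 (A *\<^sub>v w) \<le> C * vec_norm1 w" if w: "w \<in> carrier_vec (dim_col A)" for w
  proof -
    have "\<bar>(A *\<^sub>v w) $ i\<bar> \<le> (\<Sum>j<dim_col A. \<bar>A $$ (i, j)\<bar> * vec_norm1 w)" if "i < dim_row A" for i
    proof -
      have "(A *\<^sub>v w) $ i = (\<Sum>j<dim_col A. A $$ (i, j) * w $ j)"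
        using that w by (auto simp: scalar_prod_def atLeast0LessThan intro!: sum.cong)
      also have "\<bar>\<dots>\<bar> \<le> (\<Sum>j<dim_col A. \<bar>A $$ (i, j) * w $ j\<bar>)"
        by (rule sum_abs)
      also have "\<dots> \<le> (\<Sum>j<dim_col A. \<bar>A $$ (i, j)\<bar> * vec_norm1 w)"
        using w by (auto simp: abs_mult intro!: sum_mono mult_left_mono abs_index_le_vec_norm1)
      finally show ?thesis .
    qed
    then show ?thesis
      unfolding vec_norm1_def[of "A *\<^sub>v w"] C_def by (auto simp: sum_distrib_right intro!: sum_mono)
  qed
  have C0: "C \<ge> 0"
    unfolding C_def by (intro sum_nonneg) auto
  have bdd: "bdd_above {vec_norm1 (A *\<^sub>v v) | v. v \<in> carrier_vec (dim_col A) \<and> vec_norm1 v \<le> 1}"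
  proof (rule bdd_aboveI[of _ C], safe)
    fix w assume "w \<in> carrier_vec (dim_col A)" "vec_norm1 w \<le> 1"
    then show "vec_norm1 (A *\<^sub>v w) \<le> C"
      using C[of w] mult_left_mono[OF \<open>vec_norm1 w \<le> 1\<close> C0] by simp
  qed
  show ?thesis
  proof (cases "vec_norm1 v = 0")
    case True
    then show ?thesis using C[OF v] by simp
  next
    case False
    then have pos: "vec_norm1 v > 0" using vec_norm1_nonneg[of v] by simp
    let ?w = "inverse (vec_norm1 v) \<cdot>\<^sub>v v"
    have "vec_norm1 (A *\<^sub>v ?w) \<le> mat_norm1 A"
      unfolding mat_norm1_def
    proof (rule cSup_upper[OF _ bdd])
      have "?w \<in> carrier_vec (dim_col A)" "vec_norm1 ?w \<le> 1"
        using v pos by (auto simp: vec_norm1_smult)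
      then show "vec_norm1 (A *\<^sub>v ?w)
          \<in> {vec_norm1 (A *\<^sub>v v) | v. v \<in> carrier_vec (dim_col A) \<and> vec_norm1 v \<le> 1}"
        by blast
    qed
    moreover have "A *\<^sub>v ?w = inverse (vec_norm1 v) \<cdot>\<^sub>v (A *\<^sub>v v)"
      using v by (intro mult_mat_vec[of _ "dim_row A" "dim_col A"]) auto
    ultimately show ?thesis
      using pos by (simp add: vec_norm1_smult field_simps)
  qed
qed

lemma mat_norm1_le:
  assumes "\<And>v. v \<in> carrier_vec (dim_col A) \<Longrightarrow> vec_norm1 v \<le> 1 \<Longrightarrow> vec_norm1 (A *\<^sub>v v) \<le> C"
  shows "mat_norm1 A \<le> C"
  unfolding mat_norm1_def
proof (rule cSup_least)
  \<comment> \<open>The zero vector is the witness that the set is nonempty; without one a real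
    supremum would say nothing.\<close>
  have "0\<^sub>v (dim_col A) \<in> carrier_vec (dim_col A)" "vec_norm1 (0\<^sub>v (dim_col A)) \<le> 1"
    by simp_all
  then show "{vec_norm1 (A *\<^sub>v v) | v. v \<in> carrier_vec (dim_col A) \<and> vec_norm1 v \<le> 1} \<noteq> {}"
    by blast
qed (use assms in auto)

section \<open>Block vectors\<close>

definition block_vec :: "nat \<Rightarrow> nat \<Rightarrow> (nat \<Rightarrow> real vec) \<Rightarrow> real vec" where
  "block_vec d m a = vec (m * d) (\<lambda>p. a (p div d) $ (p mod d))"

definition nth_block :: "nat \<Rightarrow> real vec \<Rightarrow> nat \<Rightarrow> real vec" where
  "nth_block d v j = vec d (\<lambda>i. v $ (j * d + i))"

lemma block_vec_carrier [simp]: "block_vec d m a \<in> carrier_vec (m * d)"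
  unfolding block_vec_def by simp

lemma nth_block_carrier [simp]: "nth_block d v j \<in> carrier_vec d"
  unfolding nth_block_def by simp

lemma block_index_less: "j * d + i < m * d" if "j < m" "i < d" for i j d m :: nat
proof -
  have "j * d + i < Suc j * d" using that by simp
  also have "\<dots> \<le> m * d" using that by (intro mult_le_mono1) simp
  finally show ?thesis .
qed

lemma block_vec_index: "j < m \<Longrightarrow> i < d \<Longrightarrow> block_vec d m a $ (j * d + i) = a j $ i"
  unfolding block_vec_def using block_index_less[of j m i d] by simp

lemma block_vec_nth_block:
  assumes "v \<in> carrier_vec (m * d)"
  shows "block_vec d m (nth_block d v) = v"
proof (rule eq_vecI)
  fix p assume "p < dim_vec v"
  then have p: "p < m * d" using assms by simp
  \<comment> \<open>An index below \<open>m * d\<close> forces \<open>d\<close> to be positive, so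
    that division with remainder by \<open>d\<close> yields a block number and a position below
    \<open>d\<close>. The same step recurs wherever an index is split.\<close>
  then have "d > 0" by (cases d) auto
  then show "block_vec d m (nth_block d v) $ p = v $ p"
    using p by (simp add: block_vec_def nth_block_def)
qed (use assms in \<open>simp add: block_vec_def\<close>)

lemma sum_blocks:
  fixes f :: "nat \<Rightarrow> 'b :: comm_monoid_add"
  shows "(\<Sum>p<m * d. f p) = (\<Sum>j<m. \<Sum>i<d. f (j * d + i))"
proof -
  have "sum f {j * d..<j * d + d} = (\<Sum>i<d. f (j * d + i))" for j
    using sum.shift_bounds_nat_ivl[of f 0 "j * d" d] by (simp add: atLeast0LessThan add.commute)
  then show ?thesis
    by (simp add: sum.nat_group[symmetric])
qed

lemma vec_norm1_block_vec:
  assumes "\<And>j. j < m \<Longrightarrow> a j \<in> carrier_vec d"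
  shows "vec_norm1 (block_vec d m a) = (\<Sum>j<m. vec_norm1 (a j))"
proof -
  have "vec_norm1 (block_vec d m a) = (\<Sum>p<m * d. \<bar>block_vec d m a $ p\<bar>)"
    by (simp add: vec_norm1_def block_vec_def)
  also have "\<dots> = (\<Sum>j<m. \<Sum>i<d. \<bar>block_vec d m a $ (j * d + i)\<bar>)"
    by (rule sum_blocks)
  also have "\<dots> = (\<Sum>j<m. vec_norm1 (a j))"
    using assms[THEN carrier_vecD] by (intro sum.cong refl) (simp add: block_vec_index vec_norm1_def)
  finally show ?thesis .
qed

lemma kernel_matrix_carrier [simp]: "kernel_matrix d K m x \<in> carrier_mat (m * d) (m * d)"
  unfolding kernel_matrix_def by simp

lemma kernel_column_carrier [simp]: "kernel_column d K m x t \<in> carrier_mat (m * d) d"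
  unfolding kernel_column_def by simp

lemma mult_mat_vec_index:
  assumes "A \<in> carrier_mat n k" "v \<in> carrier_vec k" "p < n"
  shows "(A *\<^sub>v v) $ p = (\<Sum>q<k. A $$ (p, q) * v $ q)"
  using assms by (auto simp: scalar_prod_def atLeast0LessThan intro!: sum.cong)

text \<open>The argument order in the blocks of the kernel matrix is what makes its action on
  coefficients the sampling of the sum of the \<open>K (x k)\<close> applied to \<open>a k\<close>:
  row block \<open>j\<close> is the value at \<open>x j\<close>.\<close>

lemma kernel_matrix_mult_block_vec_index:
  assumes "j < m" "i < d"
    and K: "\<And>k. k < m \<Longrightarrow> K (x k) (x j) \<in> carrier_mat d d"
    and a: "\<And>k. k < m \<Longrightarrow> a k \<in> carrier_vec d"
  shows "(kernel_matrix d K m x *\<^sub>v block_vec d m a) $ (j * d + i)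
    = (\<Sum>k<m. (K (x k) (x j) *\<^sub>v a k) $ i)"
proof -
  have "(kernel_matrix d K m x *\<^sub>v block_vec d m a) $ (j * d + i)
      = (\<Sum>k<m. \<Sum>l<d. kernel_matrix d K m x $$ (j * d + i, k * d + l) * block_vec d m a $ (k * d + l))"
    using mult_mat_vec_index[of "kernel_matrix d K m x" "m * d" "m * d" "block_vec d m a" "j * d + i"]
      block_index_less[OF assms(1,2)]
    by (simp add: sum_blocks)
  also have "\<dots> = (\<Sum>k<m. \<Sum>l<d. K (x k) (x j) $$ (i, l) * a k $ l)"
    using block_index_less[OF assms(1,2)] assms(2)
    by (intro sum.cong refl) (simp add: block_vec_index kernel_matrix_def block_index_less)
  also have "\<dots> = (\<Sum>k<m. (K (x k) (x j) *\<^sub>v a k) $ i)"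
    using mult_mat_vec_index[OF K a \<open>i < d\<close>] by (intro sum.cong refl) simp
  finally show ?thesis .
qed

text \<open>Applying the kernel column to \<open>b\<close> samples the single kernel function
  centred at \<open>t\<close> with coefficient \<open>b\<close> at the points
  \<open>x j\<close>.\<close>

lemma kernel_column_mult_vec:
  assumes K: "\<And>j. j < m \<Longrightarrow> K t (x j) \<in> carrier_mat d d"
    and b: "b \<in> carrier_vec d"
  shows "kernel_column d K m x t *\<^sub>v b = block_vec d m (\<lambda>j. K t (x j) *\<^sub>v b)"
proof (rule eq_vecI)
  fix p assume "p < dim_vec (block_vec d m (\<lambda>j. K t (x j) *\<^sub>v b))"
  then have p: "p < m * d" by (simp add: block_vec_def)
  then have "d > 0" by (cases d) auto
  then have "p div d < m" "p mod d < d"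
    using p by (auto simp: less_mult_imp_div_less)
  then show "(kernel_column d K m x t *\<^sub>v b) $ p = block_vec d m (\<lambda>j. K t (x j) *\<^sub>v b) $ p"
    using p mult_mat_vec_index[OF K b] mult_mat_vec_index[OF kernel_column_carrier b p, of K x t]
    by (simp add: block_vec_def kernel_column_def)
qed (simp add: block_vec_def kernel_column_def)

section \<open>Kernel series\<close>

lemma l1_spaceD:
  assumes "c \<in> l1_space d \<Omega>"
  shows "t \<in> \<Omega> \<Longrightarrow> c t \<in> carrier_vec d" "(\<lambda>t. vec_norm1 (c t)) summable_on \<Omega>"
    "c \<in> extensional \<Omega>"
  using assms unfolding l1_space_def by (auto simp: PiE_def)

lemma admissible_kernelD:
  assumes "admissible_kernel X d K"
  shows "s \<in> X \<Longrightarrow> t \<in> X \<Longrightarrow> K s t \<in> carrier_mat d d"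
    and "m > 0 \<Longrightarrow> distinct_points X m x \<Longrightarrow> invertible_mat (kernel_matrix d K m x)"
  using assms unfolding admissible_kernel_def by auto

lemma has_sum_sum:
  fixes f :: "'i \<Rightarrow> 't \<Rightarrow> 'b :: topological_comm_monoid_add"
  assumes "\<And>i. i \<in> I \<Longrightarrow> (f i has_sum S i) A"
  shows "((\<lambda>t. \<Sum>i\<in>I. f i t) has_sum (\<Sum>i\<in>I. S i)) A"
  \<comment> \<open>For an infinite index set both sums are 0 by convention, so the claim holds
    there too.\<close>
  using assms by (induction I rule: infinite_finite_induct) (auto intro: has_sum_add has_sum_0)

lemma summable_on_norm1_bound:
  fixes f :: "'t \<Rightarrow> real"
  assumes "c \<in> l1_space d \<Omega>" "\<And>t. t \<in> \<Omega> \<Longrightarrow> \<bar>f t\<bar> \<le> C * vec_norm1 (c t)"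
  shows "f summable_on \<Omega>"
proof -
  have "(\<lambda>t. C * vec_norm1 (c t)) summable_on \<Omega>"
    using l1_spaceD(2)[OF assms(1)] by (rule summable_on_cmult_right)
  then have "f abs_summable_on \<Omega>"
    by (rule summable_on_comparison_test) (use assms(2) in auto)
  then show ?thesis by (rule abs_summable_summable)
qed

text \<open>The place where the boundedness condition (A2) enters: the constant is uniform in both
  points, so every component of a kernel series is dominated by the summable norms of the
  coefficients.\<close>

lemma kernel_term_bound:
  assumes "admissible_kernel X d K"
  obtains \<kappa> where "\<And>s t b i. s \<in> X \<Longrightarrow> t \<in> X \<Longrightarrow> b \<in> carrier_vec d \<Longrightarrow> i < d \<Longrightarrow>
    \<bar>(K t s *\<^sub>v b) $ i\<bar> \<le> \<kappa> * vec_norm1 b"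
proof -
  from assms obtain \<kappa> where \<kappa>: "\<And>s t. s \<in> X \<Longrightarrow> t \<in> X \<Longrightarrow> mat_norm1 (K s t) \<le> \<kappa>"
    unfolding admissible_kernel_def by metis
  show ?thesis
  proof (rule that[of \<kappa>])
    fix s t :: 'a and b :: "real vec" and i
    assume *: "s \<in> X" "t \<in> X" "b \<in> carrier_vec d" "i < d"
    note K = admissible_kernelD(1)[OF assms *(2,1)]
    have "\<bar>(K t s *\<^sub>v b) $ i\<bar> \<le> vec_norm1 (K t s *\<^sub>v b)"
      using K * by (intro abs_index_le_vec_norm1) simp
    also have "\<dots> \<le> mat_norm1 (K t s) * vec_norm1 b"
      using K * by (intro vec_norm1_mult_mat_vec_le) simp
    also have "\<dots> \<le> \<kappa> * vec_norm1 b"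
      using \<kappa>[OF *(2,1)] by (intro mult_right_mono vec_norm1_nonneg)
    finally show "\<bar>(K t s *\<^sub>v b) $ i\<bar> \<le> \<kappa> * vec_norm1 b" .
  qed
qed

lemma kernel_series_summable:
  assumes "admissible_kernel X d K" "c \<in> l1_space d X" "s \<in> X" "i < d"
  shows "(\<lambda>t. (K t s *\<^sub>v c t) $ i) summable_on X"
proof -
  obtain \<kappa> where \<kappa>: "\<And>s t b i. s \<in> X \<Longrightarrow> t \<in> X \<Longrightarrow> b \<in> carrier_vec d \<Longrightarrow> i < d \<Longrightarrow>
    \<bar>(K t s *\<^sub>v b) $ i\<bar> \<le> \<kappa> * vec_norm1 b"
    using kernel_term_bound[OF assms(1)] by blast
  show ?thesis
    by (rule summable_on_norm1_bound[OF assms(2)])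
      (rule \<kappa>[OF assms(3) _ l1_spaceD(1)[OF assms(2)] assms(4)])
qed

lemma mult_mat_vec_zero: "A \<in> carrier_mat n k \<Longrightarrow> A *\<^sub>v 0\<^sub>v k = 0\<^sub>v n"
  for A :: "'b :: semiring_0 mat"
  by (intro eq_vecI) auto

text \<open>Terms off the support vanish, since a matrix maps the zero vector to zero. Summing over
  all of \<open>X\<close> gives every series the same index set, which is needed to subtract two of
  them.\<close>

lemma kernel_series_index:
  assumes "admissible_kernel X d K" "s \<in> X" "i < d"
  shows "kernel_series X d K c s $ i = (\<Sum>\<^sub>\<infinity>t\<in>X. (K t s *\<^sub>v c t) $ i)"
proof -
  have "(\<Sum>\<^sub>\<infinity>t\<in>l1_supp d X c. (K t s *\<^sub>v c t) $ i) = (\<Sum>\<^sub>\<infinity>t\<in>X. (K t s *\<^sub>v c t) $ i)"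
    using assms mult_mat_vec_zero[OF admissible_kernelD(1)[OF assms(1)]]
    by (intro infsum_cong_neutral) (auto simp: l1_supp_def)
  then show ?thesis
    using assms by (simp add: kernel_series_def vec_infsum_def)
qed

lemma kernel_series_carrier: "s \<in> X \<Longrightarrow> kernel_series X d K c s \<in> carrier_vec d"
  by (simp add: kernel_series_def vec_infsum_def)

lemma l1_space_diff:
  assumes "c \<in> l1_space d \<Omega>" "c' \<in> l1_space d \<Omega>"
  shows "(\<lambda>t\<in>\<Omega>. c t - c' t) \<in> l1_space d \<Omega>"
proof -
  have "(\<lambda>t. vec_norm1 (c t) + vec_norm1 (c' t)) summable_on \<Omega>"
    using assms l1_spaceD(2) by (intro summable_on_add)
  then have "(\<lambda>t. vec_norm1 (c t - c' t)) summable_on \<Omega>"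
  proof (rule summable_on_comparison_test)
    fix t assume "t \<in> \<Omega>"
    then show "vec_norm1 (c t - c' t) \<le> vec_norm1 (c t) + vec_norm1 (c' t)"
      using l1_spaceD(1)[OF assms(1)] l1_spaceD(1)[OF assms(2)] by (intro vec_norm1_diff_le)
  qed (rule vec_norm1_nonneg)
  also have "?this \<longleftrightarrow> (\<lambda>t. vec_norm1 ((\<lambda>t\<in>\<Omega>. c t - c' t) t)) summable_on \<Omega>"
    by (intro summable_on_cong) simp
  finally show ?thesis
    using l1_spaceD(1)[OF assms(1)] l1_spaceD(1)[OF assms(2)] by (simp add: l1_space_def)
qed

lemma kernel_series_diff:
  assumes "admissible_kernel X d K" "c \<in> l1_space d X" "c' \<in> l1_space d X" "s \<in> X"
  shows "kernel_series X d K (\<lambda>t\<in>X. c t - c' t) s = kernel_series X d K c s - kernel_series X d K c' s"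
proof (rule eq_vecI)
  fix i assume "i < dim_vec (kernel_series X d K c s - kernel_series X d K c' s)"
  then have i: "i < d" using kernel_series_carrier[OF assms(4), of d K c'] by simp
  note summ = kernel_series_summable[OF assms(1) _ assms(4) i]
  have "kernel_series X d K (\<lambda>t\<in>X. c t - c' t) s $ i
      = (\<Sum>\<^sub>\<infinity>t\<in>X. (K t s *\<^sub>v c t) $ i + - (K t s *\<^sub>v c' t) $ i)"
    unfolding kernel_series_index[OF assms(1,4) i]
  proof (rule infsum_cong)
    fix t assume t: "t \<in> X"
    have "K t s *\<^sub>v (c t - c' t) = K t s *\<^sub>v c t - K t s *\<^sub>v c' t"
      using admissible_kernelD(1)[OF assms(1) t assms(4)] l1_spaceD(1)[OF assms(2) t]
        l1_spaceD(1)[OF assms(3) t]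
      by (rule mult_minus_distrib_mat_vec)
    then show "(K t s *\<^sub>v (\<lambda>t\<in>X. c t - c' t) t) $ i = (K t s *\<^sub>v c t) $ i + - (K t s *\<^sub>v c' t) $ i"
      using t i admissible_kernelD(1)[OF assms(1) t assms(4)] by simp
  qed
  also have "\<dots> = kernel_series X d K c s $ i - kernel_series X d K c' s $ i"
    unfolding kernel_series_index[OF assms(1,4) i] using summ[OF assms(2)] summ[OF assms(3)]
    by (subst infsum_add) (auto simp: infsum_uminus summable_on_uminus)
  finally show "kernel_series X d K (\<lambda>t\<in>X. c t - c' t) s $ i
      = (kernel_series X d K c s - kernel_series X d K c' s) $ i"
    using i kernel_series_carrier[OF assms(4), of d K c] kernel_series_carrier[OF assms(4), of d K c']
    by simp
qed (simp add: carrier_vecD[OF kernel_series_carrier[OF assms(4)]])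


section \<open>Inverse of the kernel matrix and uniqueness of the coefficients\<close>

lemma mat_inverse_kernel_matrix:
  assumes "admissible_kernel X d K" "m > 0" "distinct_points X m x"
  defines "A \<equiv> kernel_matrix d K m x"
  obtains B where "mat_inverse A = Some B" "A * B = 1\<^sub>m (m * d)" "B * A = 1\<^sub>m (m * d)"
    "B \<in> carrier_mat (m * d) (m * d)"
proof -
  have A: "A \<in> carrier_mat (m * d) (m * d)" by (simp add: A_def)
  from admissible_kernelD(2)[OF assms(1-3)] obtain B where
    "inverts_mat A B" "inverts_mat B A"
    unfolding invertible_mat_def A_def by blast
  then have B: "A * B = 1\<^sub>m (m * d)" "B * A = 1\<^sub>m (dim_row B)"
    using A by (auto simp: inverts_mat_def)
  \<comment> \<open>\<open>inverts_mat\<close> prescribes no size for \<open>B\<close>; its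
    dimensions are read off from the columns of the two products.\<close>
  have "dim_col (A * B) = m * d" "dim_col (B * A) = dim_row B"
    using B by simp_all
  then have Bc: "B \<in> carrier_mat (m * d) (m * d)"
    using A by (auto intro!: carrier_matI)
  \<comment> \<open>The specification of \<open>mat_inverse\<close> says that the result
    \<open>None\<close> occurs only for matrices that are not units of the matrix ring.\<close>
  have "A \<in> Units (ring_mat TYPE(real) (m * d) ())"
    using A B Bc by (auto simp: Units_def ring_mat_def)
  then obtain B' where "mat_inverse A = Some B'"
    using mat_inverse(1)[OF A, where b = "()"] by (cases "mat_inverse A") auto
  then show ?thesis using mat_inverse(2)[OF A] that by blast
qed

lemma kernel_matrix_mult_vec_eq_0D:
  assumes "admissible_kernel X d K" "m > 0" "distinct_points X m x"
    and v: "v \<in> carrier_vec (m * d)" and "kernel_matrix d K m x *\<^sub>v v = 0\<^sub>v (m * d)"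
  shows "v = 0\<^sub>v (m * d)"
proof -
  let ?A = "kernel_matrix d K m x"
  obtain B where B: "B * ?A = 1\<^sub>m (m * d)" and Bc: "B \<in> carrier_mat (m * d) (m * d)"
    using mat_inverse_kernel_matrix[OF assms(1-3)] by blast
  have "v = (B * ?A) *\<^sub>v v" using B Bc v by simp
  also have "\<dots> = B *\<^sub>v (?A *\<^sub>v v)"
    using Bc kernel_matrix_carrier v by (rule assoc_mult_mat_vec)
  also have "\<dots> = 0\<^sub>v (m * d)" using assms(5) Bc by (simp add: mult_mat_vec_zero)
  finally show ?thesis .
qed

text \<open>Condition (A3) speaks of injective sequences and so covers a countably infinite support.
  A finite support could be padded to such a sequence only when \<open>X\<close> is infinite;
  condition (A1), applied to the points of the support, treats it directly.\<close>

lemma kernel_series_eq_0D: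
  assumes adm: "admissible_kernel X d K" and c: "c \<in> l1_space d X"
    and zero: "\<And>s. s \<in> X \<Longrightarrow> kernel_series X d K c s = 0\<^sub>v d" and t: "t \<in> X"
  shows "c t = 0\<^sub>v d"
proof (rule ccontr)
  assume t0: "c t \<noteq> 0\<^sub>v d"
  let ?S = "l1_supp d X c"
  have tS: "t \<in> ?S" using t t0 by (simp add: l1_supp_def)
  have SX: "?S \<subseteq> X" by (auto simp: l1_supp_def)
  have zero': "(\<Sum>\<^sub>\<infinity>t\<in>?S. (K t s *\<^sub>v c t) $ i) = 0" if "s \<in> X" "i < d" for s i
  proof -
    have "kernel_series X d K c s $ i = 0" using zero[OF that(1)] that(2) by simp
    then show ?thesis using that by (simp add: kernel_series_def vec_infsum_def)
  qed
  show False
  proof (cases "finite ?S")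
    case True
    define m where "m = card ?S"
    have "m > 0" using True tS unfolding m_def by (auto simp: card_gt_0_iff)
    from ex_bij_betw_nat_finite[OF True] obtain x where x: "bij_betw x {..<m} ?S"
      unfolding m_def atLeast0LessThan by blast
    have xX: "x j \<in> X" if "j < m" for j
      using bij_betw_apply[OF x] that SX by auto
    have dp: "distinct_points X m x"
      using x SX by (auto simp: distinct_points_def bij_betw_def)
    let ?v = "block_vec d m (\<lambda>j. c (x j))"
    \<comment> \<open>The row blocks of this product are the values of the series at the points of
      its own support, all of which vanish.\<close>
    have "kernel_matrix d K m x *\<^sub>v ?v = 0\<^sub>v (m * d)"
    proof (rule eq_vecI)
      fix p assume "p < dim_vec (0\<^sub>v (m * d) :: real vec)"
      then have p: "p < m * d" by simp
      then have "d > 0" by (cases d) auto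
      then have j: "p div d < m" and i: "p mod d < d"
        using p by (auto simp: less_mult_imp_div_less)
      have "(kernel_matrix d K m x *\<^sub>v ?v) $ (p div d * d + p mod d)
          = (\<Sum>k<m. (K (x k) (x (p div d)) *\<^sub>v c (x k)) $ (p mod d))"
        using admissible_kernelD(1)[OF adm] l1_spaceD(1)[OF c] xX j i
        by (intro kernel_matrix_mult_block_vec_index) auto
      also have "\<dots> = (\<Sum>t\<in>?S. (K t (x (p div d)) *\<^sub>v c t) $ (p mod d))"
        by (rule sum.reindex_bij_betw[OF x])
      also have "\<dots> = 0" using zero'[OF xX[OF j] i] True by simp
      finally show "(kernel_matrix d K m x *\<^sub>v ?v) $ p = 0\<^sub>v (m * d) $ p"
        using p by simp
    qed (simp add: kernel_matrix_def)
    then have v0: "?v = 0\<^sub>v (m * d)"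
      using kernel_matrix_mult_vec_eq_0D[OF adm \<open>m > 0\<close> dp block_vec_carrier] by blast
    have "t \<in> x ` {..<m}" using tS bij_betw_imp_surj_on[OF x] by simp
    then obtain k where k: "k < m" "x k = t" by auto
    have "c t = 0\<^sub>v d"
    proof (rule eq_vecI)
      fix i assume i: "i < dim_vec (0\<^sub>v d :: real vec)"
      then have "c t $ i = ?v $ (k * d + i)" using k by (simp add: block_vec_index)
      also have "\<dots> = 0" using v0 block_index_less[OF k(1), of i d] i by simp
      finally show "c t $ i = 0\<^sub>v d $ i" using i by simp
    qed (use l1_spaceD(1)[OF c t] in simp)
    then show False using t0 by simp
  next
    case False
    \<comment> \<open>A summable family has only countably many nonzero terms, so an infinite
      support can be enumerated by the natural numbers.\<close>
    have "?S \<subseteq> {t \<in> X. vec_norm1 (c t) \<noteq> 0}"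
      using vec_norm1_eq_0D l1_spaceD(1)[OF c] by (fastforce simp: l1_supp_def)
    moreover have "countable {t \<in> X. vec_norm1 (c t) \<noteq> 0}"
      using l1_spaceD(2)[OF c] by (intro abs_summable_countable) (simp add: vec_norm1_nonneg)
    ultimately have "countable ?S" by (rule countable_subset)
    with False obtain x :: "nat \<Rightarrow> 'a" where x: "bij_betw x UNIV ?S"
      using bij_betw_from_nat_into by blast
    have xX: "x j \<in> X" for j
      using bij_betw_apply[OF x] SX by auto
    have "(\<lambda>t. vec_norm1 (c t)) summable_on ?S"
      using l1_spaceD(2)[OF c] SX by (rule summable_on_subset)
    then have "(\<lambda>j. vec_norm1 (c (x j))) summable_on UNIV"
      using summable_on_reindex_bij_betw[OF x] by fast
    then have "(\<lambda>j. c (x j)) \<in> l1_space d UNIV"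
      using l1_spaceD(1)[OF c xX] by (auto simp: l1_space_def)
    moreover have "vec_infsum d (\<lambda>j. K (x j) s *\<^sub>v c (x j)) UNIV = 0\<^sub>v d" if "s \<in> X" for s
    proof (rule eq_vecI)
      fix i assume "i < dim_vec (0\<^sub>v d :: real vec)"
      then show "vec_infsum d (\<lambda>j. K (x j) s *\<^sub>v c (x j)) UNIV $ i = 0\<^sub>v d $ i"
        using zero'[OF that] infsum_reindex_bij_betw[OF x, of "\<lambda>t. (K t s *\<^sub>v c t) $ i"]
        by (simp add: vec_infsum_def)
    qed (simp add: vec_infsum_def)
    moreover have "range x \<subseteq> X" "inj x"
      using x SX by (auto simp: bij_betw_def)
    ultimately have "c (x j) = 0\<^sub>v d" for j
      using adm unfolding admissible_kernel_def by blast
    moreover have "t \<in> range x" using tS bij_betw_imp_surj_on[OF x] by simp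
    then obtain j where "x j = t" by auto
    ultimately show False using t0 by blast
  qed
qed

text \<open>The difference of the coefficients has vanishing series, hence is zero on
  \<open>X\<close>. Agreement on \<open>X\<close> is full equality because members of
  \<open>l1_space\<close> are extensional.\<close>

lemma kernel_series_inj:
  assumes adm: "admissible_kernel X d K"
    and c: "c \<in> l1_space d X" and c': "c' \<in> l1_space d X"
    and eq: "kernel_series X d K c = kernel_series X d K c'"
  shows "c = c'"
proof (rule extensionalityI[OF l1_spaceD(3)[OF c] l1_spaceD(3)[OF c']])
  fix t assume t: "t \<in> X"
  have "kernel_series X d K (\<lambda>t\<in>X. c t - c' t) s = 0\<^sub>v d" if "s \<in> X" for s
    using kernel_series_diff[OF adm c c' that] kernel_series_carrier[OF that, of d K c'] eq by simp
  from kernel_series_eq_0D[OF adm l1_space_diff[OF c c'] this t]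
  have diff: "c t - c' t = 0\<^sub>v d" using t by simp
  show "c t = c' t"
  proof (rule eq_vecI)
    fix i assume "i < dim_vec (c' t)"
    moreover from this have "(c t - c' t) $ i = 0"
      using diff l1_spaceD(1)[OF c' t] by simp
    ultimately show "c t $ i = c' t $ i" by simp
  qed (use l1_spaceD(1)[OF c t] l1_spaceD(1)[OF c' t] in simp)
qed

text \<open>Injectivity of the series shows that the definite description in \<open>B_norm\<close>
  has a unique candidate.\<close>

lemma B_norm_kernel_series:
  assumes "admissible_kernel X d K" "c \<in> l1_space d X"
  shows "B_norm X d K (kernel_series X d K c) = l1_norm X c"
  unfolding B_norm_def using assms kernel_series_inj[OF assms(1)] by (intro the_equality) auto

section \<open>Finitely supported coefficients\<close>

definition spread_coeffs ::
    "'a set \<Rightarrow> nat \<Rightarrow> nat \<Rightarrow> (nat \<Rightarrow> 'a) \<Rightarrow> (nat \<Rightarrow> real vec) \<Rightarrow> 'a \<Rightarrow> real vec" where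
  "spread_coeffs X d m x a =
     (\<lambda>t\<in>X. if t \<in> x ` {..<m} then a (the_inv_into {..<m} x t) else 0\<^sub>v d)"

lemma
  assumes "distinct_points X m x"
  shows spread_coeffs_point: "j < m \<Longrightarrow> spread_coeffs X d m x a (x j) = a j"
    and spread_coeffs_outside: "t \<in> X - x ` {..<m} \<Longrightarrow> spread_coeffs X d m x a t = 0\<^sub>v d"
  using assms by (auto simp: spread_coeffs_def distinct_points_def the_inv_into_f_f)

text \<open>The function \<open>f\<close> is kept general, vanishing at the zero vector, so that one
  finite-support argument evaluates both the norm of the coefficients and each component of their
  kernel series.\<close>

lemma has_sum_spread_coeffs:
  fixes f :: "'a \<Rightarrow> real vec \<Rightarrow> real"
  assumes "distinct_points X m x" "\<And>t. t \<in> X \<Longrightarrow> f t (0\<^sub>v d) = 0"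
  shows "((\<lambda>t. f t (spread_coeffs X d m x a t)) has_sum (\<Sum>j<m. f (x j) (a j))) X"
proof -
  have xX: "x ` {..<m} \<subseteq> X" and inj: "inj_on x {..<m}"
    using assms(1) by (auto simp: distinct_points_def)
  have "(\<Sum>t\<in>x ` {..<m}. f t (spread_coeffs X d m x a t)) = (\<Sum>j<m. f (x j) (a j))"
    using inj spread_coeffs_point[OF assms(1)] by (simp add: sum.reindex)
  then show ?thesis
    using xX assms(2) spread_coeffs_outside[OF assms(1)]
    by (intro has_sum_finite_neutralI[of "x ` {..<m}"]) auto
qed

lemma
  assumes dp: "distinct_points X m x" and a: "\<And>j. j < m \<Longrightarrow> a j \<in> carrier_vec d"
  shows spread_coeffs_l1: "spread_coeffs X d m x a \<in> l1_space d X"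
    and l1_norm_spread_coeffs: "l1_norm X (spread_coeffs X d m x a) = (\<Sum>j<m. vec_norm1 (a j))"
proof -
  have *: "((\<lambda>t. vec_norm1 (spread_coeffs X d m x a t)) has_sum (\<Sum>j<m. vec_norm1 (a j))) X"
    using has_sum_spread_coeffs[OF dp, of "\<lambda>_. vec_norm1" d a] by simp
  then show "l1_norm X (spread_coeffs X d m x a) = (\<Sum>j<m. vec_norm1 (a j))"
    unfolding l1_norm_def by (rule infsumI)
  have "spread_coeffs X d m x a t \<in> carrier_vec d" if "t \<in> X" for t
    using a spread_coeffs_outside[OF dp, of t d a] spread_coeffs_point[OF dp, of _ d a] that
    by (cases "t \<in> x ` {..<m}") auto
  then show "spread_coeffs X d m x a \<in> l1_space d X"
    using has_sum_imp_summable[OF *] by (auto simp: l1_space_def spread_coeffs_def)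
qed

text \<open>Presents the finite sums that form \<open>kernel_span\<close> as kernel series, which
  makes their norm computable by \<open>B_norm_kernel_series\<close>.\<close>

lemma kernel_series_spread_coeffs:
  assumes adm: "admissible_kernel X d K" and dp: "distinct_points X m x"
    and a: "\<And>j. j < m \<Longrightarrow> a j \<in> carrier_vec d"
  shows "kernel_series X d K (spread_coeffs X d m x a)
    = (\<lambda>s\<in>X. finsum_vec TYPE(real) d (\<lambda>j. K (x j) s *\<^sub>v a j) {..<m})"
proof (rule extensionalityI[of _ X])
  fix s assume s: "s \<in> X"
  have xX: "x j \<in> X" if "j < m" for j using dp that by (auto simp: distinct_points_def)
  have carr: "(\<lambda>j. K (x j) s *\<^sub>v a j) \<in> {..<m} \<rightarrow> carrier_vec d"
    using mult_mat_vec_carrier[OF admissible_kernelD(1)[OF adm xX s] a] by auto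
  show "kernel_series X d K (spread_coeffs X d m x a) s
      = (\<lambda>s\<in>X. finsum_vec TYPE(real) d (\<lambda>j. K (x j) s *\<^sub>v a j) {..<m}) s"
  proof (rule eq_vecI)
    show "dim_vec (kernel_series X d K (spread_coeffs X d m x a) s)
        = dim_vec ((\<lambda>s\<in>X. finsum_vec TYPE(real) d (\<lambda>j. K (x j) s *\<^sub>v a j) {..<m}) s)"
      using finsum_vec_closed[OF carr] kernel_series_carrier[OF s, of d K] s by (simp add: carrier_vecD)
  next
    fix i assume "i < dim_vec ((\<lambda>s\<in>X. finsum_vec TYPE(real) d (\<lambda>j. K (x j) s *\<^sub>v a j) {..<m}) s)"
    then have i: "i < d" using finsum_vec_closed[OF carr] s by (simp add: carrier_vecD)
    have "((\<lambda>t. (K t s *\<^sub>v spread_coeffs X d m x a t) $ i) has_sum (\<Sum>j<m. (K (x j) s *\<^sub>v a j) $ i)) X"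
      using mult_mat_vec_zero[OF admissible_kernelD(1)[OF adm _ s]] i
      by (intro has_sum_spread_coeffs[OF dp, of "\<lambda>t b. (K t s *\<^sub>v b) $ i"]) simp
    then have "kernel_series X d K (spread_coeffs X d m x a) s $ i = (\<Sum>j<m. (K (x j) s *\<^sub>v a j) $ i)"
      unfolding kernel_series_index[OF adm s i] by (rule infsumI)
    also have "\<dots> = finsum_vec TYPE(real) d (\<lambda>j. K (x j) s *\<^sub>v a j) {..<m} $ i"
      by (rule index_finsum_vec[OF _ i carr, symmetric]) simp
    finally show "kernel_series X d K (spread_coeffs X d m x a) s $ i
        = (\<lambda>s\<in>X. finsum_vec TYPE(real) d (\<lambda>j. K (x j) s *\<^sub>v a j) {..<m}) s $ i"
      using s by simp
  qed
qed (auto simp: kernel_series_def)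

lemma kernel_series_spread_coeffs_point:
  assumes adm: "admissible_kernel X d K" and dp: "distinct_points X m x"
    and a: "\<And>j. j < m \<Longrightarrow> a j \<in> carrier_vec d" and "j < m" "i < d"
  shows "kernel_series X d K (spread_coeffs X d m x a) (x j) $ i
    = (kernel_matrix d K m x *\<^sub>v block_vec d m a) $ (j * d + i)"
proof -
  have xX: "x j \<in> X" if "j < m" for j using dp that by (auto simp: distinct_points_def)
  have carr: "(\<lambda>k. K (x k) (x j) *\<^sub>v a k) \<in> {..<m} \<rightarrow> carrier_vec d"
    using mult_mat_vec_carrier[OF admissible_kernelD(1)[OF adm xX xX[OF \<open>j < m\<close>]] a] by auto
  have "kernel_series X d K (spread_coeffs X d m x a) (x j) $ i = (\<Sum>k<m. (K (x k) (x j) *\<^sub>v a k) $ i)"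
    using index_finsum_vec[OF _ \<open>i < d\<close> carr] xX[OF \<open>j < m\<close>]
    by (simp add: kernel_series_spread_coeffs[OF adm dp a])
  also have "\<dots> = (kernel_matrix d K m x *\<^sub>v block_vec d m a) $ (j * d + i)"
    using admissible_kernelD(1)[OF adm xX xX[OF \<open>j < m\<close>]] a
    by (intro kernel_matrix_mult_block_vec_index[OF \<open>j < m\<close> \<open>i < d\<close>, symmetric])
  finally show ?thesis .
qed

section \<open>Minimal norm interpolation\<close>

lemma kernel_span_eq:
  assumes "admissible_kernel X d K" "distinct_points X m x"
  shows "kernel_span X d K m x
    = {kernel_series X d K (spread_coeffs X d m x a) | a. \<forall>j<m. a j \<in> carrier_vec d}"
  unfolding kernel_span_def
  by (intro Collect_cong ex_cong1 rev_conj_cong refl) (simp add: kernel_series_spread_coeffs[OF assms])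

text \<open>Sampling a finite kernel sum at its own centres is multiplication by the kernel matrix,
  so interpolation from the span is a square linear system for the coefficients.\<close>

lemma kernel_series_spread_interpolates_iff:
  assumes adm: "admissible_kernel X d K" and dp: "distinct_points X m x"
    and a: "\<And>j. j < m \<Longrightarrow> a j \<in> carrier_vec d" and y: "\<And>j. j < m \<Longrightarrow> y j \<in> carrier_vec d"
  shows "(\<forall>j<m. kernel_series X d K (spread_coeffs X d m x a) (x j) = y j)
    \<longleftrightarrow> kernel_matrix d K m x *\<^sub>v block_vec d m a = block_vec d m y"
proof
  assume eq: "\<forall>j<m. kernel_series X d K (spread_coeffs X d m x a) (x j) = y j"
  show "kernel_matrix d K m x *\<^sub>v block_vec d m a = block_vec d m y"
  proof (rule eq_vecI)
    fix p assume "p < dim_vec (block_vec d m y)"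
    then have p: "p < m * d" by (simp add: block_vec_def)
    then have "d > 0" by (cases d) auto
    then have ji: "p div d < m" "p mod d < d"
      using p by (auto simp: less_mult_imp_div_less)
    then have "(kernel_matrix d K m x *\<^sub>v block_vec d m a) $ (p div d * d + p mod d) = y (p div d) $ (p mod d)"
      using kernel_series_spread_coeffs_point[where a = a, OF adm dp a ji] eq by simp
    then show "(kernel_matrix d K m x *\<^sub>v block_vec d m a) $ p = block_vec d m y $ p"
      using p by (simp add: block_vec_def)
  qed (simp add: kernel_matrix_def block_vec_def)
next
  assume eq: "kernel_matrix d K m x *\<^sub>v block_vec d m a = block_vec d m y"
  show "\<forall>j<m. kernel_series X d K (spread_coeffs X d m x a) (x j) = y j"
  proof (intro allI impI)
    fix j assume j: "j < m"
    then have "x j \<in> X" using dp by (auto simp: distinct_points_def)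
    note carr = kernel_series_carrier[OF this, of d K "spread_coeffs X d m x a"]
    show "kernel_series X d K (spread_coeffs X d m x a) (x j) = y j"
    proof (rule eq_vecI)
      fix i assume "i < dim_vec (y j)"
      then have i: "i < d" using y[OF j] by simp
      show "kernel_series X d K (spread_coeffs X d m x a) (x j) $ i = y j $ i"
        using kernel_series_spread_coeffs_point[where a = a, OF adm dp a j i] eq block_vec_index[OF j i, of y] by simp
    qed (use carr y[OF j] in simp)
  qed
qed

text \<open>The right inverse identity makes \<open>v\<close> a solution of the linear system, which
  gives existence; the left inverse identity makes it the only solution, so the coefficients of
  every span interpolant are the blocks of \<open>v\<close>.\<close>

lemma span_interpolant:
  assumes adm: "admissible_kernel X d K" and m: "m > 0" and dp: "distinct_points X m x"
    and y: "\<And>j. j < m \<Longrightarrow> y j \<in> carrier_vec d"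
  defines "v \<equiv> the (mat_inverse (kernel_matrix d K m x)) *\<^sub>v block_vec d m y"
  shows "\<exists>g\<in>kernel_span X d K m x. g \<in> interpolants X d K m x y"
    and "f \<in> kernel_span X d K m x \<Longrightarrow> f \<in> interpolants X d K m x y \<Longrightarrow> B_norm X d K f = vec_norm1 v"
proof -
  let ?A = "kernel_matrix d K m x"
  obtain B where B: "mat_inverse ?A = Some B" "?A * B = 1\<^sub>m (m * d)" "B * ?A = 1\<^sub>m (m * d)"
    "B \<in> carrier_mat (m * d) (m * d)"
    using mat_inverse_kernel_matrix[OF adm m dp] by blast
  have v: "v \<in> carrier_vec (m * d)" using B by (simp add: v_def)
  have "?A *\<^sub>v v = (?A * B) *\<^sub>v block_vec d m y"
    unfolding v_def B(1) option.sel
    using kernel_matrix_carrier B(4) block_vec_carrier by (rule assoc_mult_mat_vec[symmetric])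
  then have Av: "?A *\<^sub>v block_vec d m (nth_block d v) = block_vec d m y"
    using B(2) v by (simp add: block_vec_nth_block)
  let ?g = "kernel_series X d K (spread_coeffs X d m x (nth_block d v))"
  have "?g \<in> kernel_span X d K m x"
    unfolding kernel_span_eq[OF adm dp] by auto
  moreover have "\<forall>j<m. ?g (x j) = y j"
    using Av kernel_series_spread_interpolates_iff[where a = "nth_block d v" and y = y, OF adm dp _ y] by simp
  then have "?g \<in> interpolants X d K m x y"
    unfolding interpolants_def B_space_def by (auto intro!: imageI spread_coeffs_l1[OF dp])
  ultimately show "\<exists>g\<in>kernel_span X d K m x. g \<in> interpolants X d K m x y" by blast
next
  let ?A = "kernel_matrix d K m x"
  obtain B where B: "mat_inverse ?A = Some B" "?A * B = 1\<^sub>m (m * d)" "B * ?A = 1\<^sub>m (m * d)"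
    "B \<in> carrier_mat (m * d) (m * d)"
    using mat_inverse_kernel_matrix[OF adm m dp] by blast
  assume "f \<in> kernel_span X d K m x" "f \<in> interpolants X d K m x y"
  then obtain a where f: "f = kernel_series X d K (spread_coeffs X d m x a)"
    and a: "\<And>j. j < m \<Longrightarrow> a j \<in> carrier_vec d" and int: "\<forall>j<m. f (x j) = y j"
    unfolding kernel_span_eq[OF adm dp] interpolants_def by auto
  have "?A *\<^sub>v block_vec d m a = block_vec d m y"
    using int kernel_series_spread_interpolates_iff[where a = a and y = y, OF adm dp a y] unfolding f by blast
  then have "v = B *\<^sub>v (?A *\<^sub>v block_vec d m a)"
    by (simp add: v_def B(1))
  also have "\<dots> = (B * ?A) *\<^sub>v block_vec d m a"
    using B(4) kernel_matrix_carrier block_vec_carrier by (rule assoc_mult_mat_vec[symmetric])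
  finally have "v = block_vec d m a"
    by (simp add: B(3))
  then show "B_norm X d K f = vec_norm1 v"
    using B_norm_kernel_series[OF adm spread_coeffs_l1[where a = a, OF dp a]]
      l1_norm_spread_coeffs[where a = a, OF dp a] vec_norm1_block_vec[where a = a, OF a]
    unfolding f by metis
qed

text \<open>The matrix \<open>B\<close> passes through the series, whose term at \<open>t\<close>
  then becomes \<open>B * kernel_column d K m x t\<close> applied to \<open>c t\<close>. By
  \<open>bound\<close> each such term has norm at most that of \<open>c t\<close>.\<close>

lemma vec_norm1_mult_samples_le:
  assumes adm: "admissible_kernel X d K" and x: "\<And>j. j < m \<Longrightarrow> x j \<in> X"
    and c: "c \<in> l1_space d X" and B: "B \<in> carrier_mat n (m * d)"
    and bound: "\<And>t. t \<in> X \<Longrightarrow> mat_norm1 (B * kernel_column d K m x t) \<le> 1"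
  shows "vec_norm1 (B *\<^sub>v block_vec d m (\<lambda>j. kernel_series X d K c (x j))) \<le> l1_norm X c"
proof -
  \<comment> \<open>The contribution of the single centre \<open>t\<close> to the product of
    \<open>B\<close> with the samples.\<close>
  define w where "w t = B *\<^sub>v block_vec d m (\<lambda>j. K t (x j) *\<^sub>v c t)" for t
  have w_eq: "w t = (B * kernel_column d K m x t) *\<^sub>v c t" if t: "t \<in> X" for t
    unfolding w_def assoc_mult_mat_vec[OF B kernel_column_carrier l1_spaceD(1)[OF c t]]
    by (intro arg_cong[where f = "(*\<^sub>v) B"] kernel_column_mult_vec[symmetric]
        admissible_kernelD(1)[OF adm t x] l1_spaceD(1)[OF c t])
  have w_le: "vec_norm1 (w t) \<le> vec_norm1 (c t)" if t: "t \<in> X" for t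
  proof -
    have "vec_norm1 (w t) \<le> mat_norm1 (B * kernel_column d K m x t) * vec_norm1 (c t)"
      unfolding w_eq[OF t] using l1_spaceD(1)[OF c t] B
      by (intro vec_norm1_mult_mat_vec_le) (simp add: kernel_column_def)
    also have "\<dots> \<le> 1 * vec_norm1 (c t)"
      using bound[OF t] by (intro mult_right_mono vec_norm1_nonneg)
    finally show ?thesis by simp
  qed
  have w_carr: "w t \<in> carrier_vec n" for t
    using B by (simp add: w_def)
  have w_summable: "(\<lambda>t. \<bar>w t $ p\<bar>) summable_on X" if "p < n" for p
  proof (rule summable_on_norm1_bound[OF c, of _ 1])
    fix t assume "t \<in> X"
    then show "\<bar>\<bar>w t $ p\<bar>\<bar> \<le> 1 * vec_norm1 (c t)"
      using w_le[of t] abs_index_le_vec_norm1[of p "w t"] w_carr[of t] that by simp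
  qed
  let ?y = "block_vec d m (\<lambda>j. kernel_series X d K c (x j))"
  have By: "(B *\<^sub>v ?y) $ p = (\<Sum>\<^sub>\<infinity>t\<in>X. w t $ p)" if p: "p < n" for p
  proof -
    have "((\<lambda>t. w t $ p) has_sum (B *\<^sub>v ?y) $ p) X"
    proof -
      \<comment> \<open>Each entry of the product is a finite combination of components of samples,
        and each of these components is a convergent series over \<open>t\<close>; hence the
        combination may be taken termwise.\<close>
      have "((\<lambda>t. \<Sum>q<m * d. B $$ (p, q) * block_vec d m (\<lambda>j. K t (x j) *\<^sub>v c t) $ q)
          has_sum (\<Sum>q<m * d. B $$ (p, q) * ?y $ q)) X"
      proof (intro has_sum_sum has_sum_cmult_right)
        fix q assume "q \<in> {..<m * d}"
        then have q: "q < m * d" by simp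
        then have "d > 0" by (cases d) auto
        then have ji: "q div d < m" "q mod d < d"
          using q by (auto simp: less_mult_imp_div_less)
        have "((\<lambda>t. (K t (x (q div d)) *\<^sub>v c t) $ (q mod d))
            has_sum kernel_series X d K c (x (q div d)) $ (q mod d)) X"
          unfolding kernel_series_index[OF adm x[OF ji(1)] ji(2)]
          by (intro has_sum_infsum kernel_series_summable[OF adm c x[OF ji(1)] ji(2)])
        then show "((\<lambda>t. block_vec d m (\<lambda>j. K t (x j) *\<^sub>v c t) $ q) has_sum ?y $ q) X"
          using q by (simp add: block_vec_def)
      qed
      then show ?thesis
        unfolding w_def using mult_mat_vec_index[OF B block_vec_carrier p] by simp
    qed
    then show ?thesis by (rule infsumI[symmetric])
  qed
  have "vec_norm1 (B *\<^sub>v ?y) = (\<Sum>p<n. \<bar>\<Sum>\<^sub>\<infinity>t\<in>X. w t $ p\<bar>)"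
    using B By by (simp add: vec_norm1_def)
  also have "\<dots> \<le> (\<Sum>p<n. \<Sum>\<^sub>\<infinity>t\<in>X. \<bar>w t $ p\<bar>)"
    using norm_infsum_bound[of "\<lambda>t. w t $ p" X for p] w_summable by (intro sum_mono) auto
  \<comment> \<open>Only finitely many components \<open>p\<close> occur, so summability of each one
    suffices for the interchange.\<close>
  also have "\<dots> = (\<Sum>\<^sub>\<infinity>t\<in>X. \<Sum>p<n. \<bar>w t $ p\<bar>)"
    using w_summable by (intro infsumI[symmetric] has_sum_sum has_sum_infsum) auto
  also have "\<dots> = (\<Sum>\<^sub>\<infinity>t\<in>X. vec_norm1 (w t))"
    by (simp add: vec_norm1_def carrier_vecD[OF w_carr])
  also have "\<dots> \<le> l1_norm X c"
    unfolding l1_norm_def using w_le l1_spaceD(2)[OF c]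
    by (intro infsum_mono summable_on_norm1_bound[OF c, of _ 1]) (auto simp: vec_norm1_nonneg)
  finally show ?thesis .
qed

section \<open>The two implications\<close>

lemma linear_representer_imp_bound:
  assumes adm: "admissible_kernel X d K" and lrt: "linear_representer_theorem X d K"
    and m: "m > 0" and dp: "distinct_points X m x" and t: "t \<in> X"
  shows "mat_norm1 (the (mat_inverse (kernel_matrix d K m x)) * kernel_column d K m x t) \<le> 1"
proof -
  let ?B = "the (mat_inverse (kernel_matrix d K m x))"
  have xX: "x j \<in> X" if "j < m" for j using dp that by (auto simp: distinct_points_def)
  obtain B where "mat_inverse (kernel_matrix d K m x) = Some B" "B \<in> carrier_mat (m * d) (m * d)"
    using mat_inverse_kernel_matrix[OF adm m dp] by blast
  then have B: "?B \<in> carrier_mat (m * d) (m * d)" by simp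
  show "mat_norm1 (?B * kernel_column d K m x t) \<le> 1"
  proof (rule mat_norm1_le)
    fix b assume "b \<in> carrier_vec (dim_col (?B * kernel_column d K m x t))" and b1: "vec_norm1 b \<le> 1"
    then have b: "b \<in> carrier_vec d" by (simp add: kernel_column_def)
    \<comment> \<open>These data are the samples of the kernel function at \<open>t\<close> with
      coefficient \<open>b\<close>; their image under \<open>?B\<close> is the vector to be
      bounded.\<close>
    define y where "y = (\<lambda>j. K t (x j) *\<^sub>v b)"
    have y: "y j \<in> carrier_vec d" if "j < m" for j
      using mult_mat_vec_carrier[OF admissible_kernelD(1)[OF adm t xX[OF that]] b] by (simp add: y_def)
    \<comment> \<open>A one-point family centred at \<open>t\<close> realises the sampled function
      as the kernel series \<open>h\<close> with the single coefficient \<open>b\<close>, so its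
      norm is that of \<open>b\<close>.\<close>
    have dpt: "distinct_points X 1 (\<lambda>_. t)" using t by (auto simp: distinct_points_def inj_on_def)
    define h where "h = kernel_series X d K (spread_coeffs X d 1 (\<lambda>_. t) (\<lambda>_. b))"
    have hl: "spread_coeffs X d 1 (\<lambda>_. t) (\<lambda>_. b) \<in> l1_space d X"
      by (intro spread_coeffs_l1 dpt b)
    have "h (x j) = y j" if j: "j < m" for j
    proof (rule eq_vecI)
      fix i assume "i < dim_vec (y j)"
      then have i: "i < d" using y[OF j] by simp
      have "(\<lambda>k::nat. K t (x j) *\<^sub>v b) \<in> {..<1} \<rightarrow> carrier_vec d"
        using y[OF j] by (simp add: y_def)
      from index_finsum_vec[OF _ i this] show "h (x j) $ i = y j $ i"
        using xX[OF j] kernel_series_spread_coeffs[where a = "\<lambda>_. b", OF adm dpt b]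
        by (simp add: h_def y_def)
    qed (use kernel_series_carrier[OF xX[OF j], of d K] y[OF j] in \<open>simp add: h_def carrier_vecD\<close>)
    then have h: "h \<in> interpolants X d K m x y"
      using hl by (simp add: interpolants_def B_space_def h_def)
    have "B_norm X d K h = vec_norm1 b"
      unfolding h_def B_norm_kernel_series[OF adm hl]
      using l1_norm_spread_coeffs[where a = "\<lambda>_. b", OF dpt b] by simp
    moreover obtain f where f: "f \<in> kernel_span X d K m x" "min_norm_interpolant X d K m x y f"
      using lrt[unfolded linear_representer_theorem_def, rule_format, of m x y] m dp y by auto
    from f(2) have fi: "f \<in> interpolants X d K m x y"
      and min: "\<And>g. g \<in> interpolants X d K m x y \<Longrightarrow> B_norm X d K f \<le> B_norm X d K g"
      unfolding min_norm_interpolant_def is_arg_min_linorder by simp_all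
    \<comment> \<open>The minimizer in the span has norm \<open>vec_norm1\<close> of
      \<open>?B\<close> applied to the data, and minimality puts this below the norm of
      \<open>h\<close>, which is at most 1.\<close>
    note min[OF h]
    moreover have "B_norm X d K f = vec_norm1 (?B *\<^sub>v block_vec d m y)"
      using span_interpolant(2)[where y = y, OF adm m dp y f(1) fi] .
    moreover have "(?B * kernel_column d K m x t) *\<^sub>v b = ?B *\<^sub>v block_vec d m y"
      unfolding assoc_mult_mat_vec[OF B kernel_column_carrier b] y_def
      by (intro arg_cong[where f = "(*\<^sub>v) ?B"] kernel_column_mult_vec
          admissible_kernelD(1)[OF adm t xX] b)
    ultimately show "vec_norm1 ((?B * kernel_column d K m x t) *\<^sub>v b) \<le> 1"
      using b1 by simp
  qed
qed

lemma bound_imp_linear_representer: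
  assumes adm: "admissible_kernel X d K"
    and bounded: "\<And>m x t. m > 0 \<Longrightarrow> distinct_points X m x \<Longrightarrow> t \<in> X \<Longrightarrow>
      mat_norm1 (the (mat_inverse (kernel_matrix d K m x)) * kernel_column d K m x t) \<le> 1"
  shows "linear_representer_theorem X d K"
  unfolding linear_representer_theorem_def
proof (intro allI impI, elim conjE)
  fix m :: nat and x and y :: "nat \<Rightarrow> real vec"
  assume m: "m > 0" and dp: "distinct_points X m x" and y: "\<forall>j<m. y j \<in> carrier_vec d"
  let ?B = "the (mat_inverse (kernel_matrix d K m x))"
  have xX: "x j \<in> X" if "j < m" for j using dp that by (auto simp: distinct_points_def)
  obtain B where "mat_inverse (kernel_matrix d K m x) = Some B" "B \<in> carrier_mat (m * d) (m * d)"
    using mat_inverse_kernel_matrix[OF adm m dp] by blast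
  then have B: "?B \<in> carrier_mat (m * d) (m * d)" by simp
  \<comment> \<open>The interpolant from the span is itself shown to be minimal, by comparing its
    norm with that of an arbitrary interpolant.\<close>
  obtain g where g: "g \<in> kernel_span X d K m x" "g \<in> interpolants X d K m x y"
    using span_interpolant(1)[where y = y, OF adm m dp] y by blast
  have "B_norm X d K g \<le> B_norm X d K f" if "f \<in> interpolants X d K m x y" for f
  proof -
    from that obtain c where c: "c \<in> l1_space d X" and f: "f = kernel_series X d K c"
      and int: "\<And>j. j < m \<Longrightarrow> f (x j) = y j"
      by (auto simp: interpolants_def B_space_def)
    \<comment> \<open>A block vector reads only blocks with index below \<open>m\<close>, and there
      the data are the samples of \<open>f\<close>.\<close>
    have "block_vec d m y = block_vec d m (\<lambda>j. kernel_series X d K c (x j))"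
      unfolding block_vec_def using int f by (intro eq_vecI) (simp_all add: less_mult_imp_div_less)
    moreover have "vec_norm1 (?B *\<^sub>v block_vec d m (\<lambda>j. kernel_series X d K c (x j))) \<le> l1_norm X c"
      by (rule vec_norm1_mult_samples_le[OF adm _ c B]) (use xX bounded[OF m dp] in blast)+
    moreover have "B_norm X d K g = vec_norm1 (?B *\<^sub>v block_vec d m y)"
      using span_interpolant(2)[where y = y, OF adm m dp _ g] y by blast
    ultimately show ?thesis
      by (simp add: f B_norm_kernel_series[OF adm c])
  qed
  then show "\<exists>f\<in>kernel_span X d K m x. min_norm_interpolant X d K m x y f"
    using g unfolding min_norm_interpolant_def is_arg_min_linorder by blast
qed

theorem theorem3p2:
  fixes X :: "'a set" and d :: nat and K :: "'a \<Rightarrow> 'a \<Rightarrow> real mat"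
  assumes "X \<noteq> {}"
    and "d > 0"
    and "admissible_kernel X d K"
    and "\<And>m x y. m > 0 \<Longrightarrow> distinct_points X m x \<Longrightarrow> (\<And>j. j < m \<Longrightarrow> y j \<in> carrier_vec d) \<Longrightarrow>
           \<exists>f. min_norm_interpolant X d K m x y f"
  shows "linear_representer_theorem X d K \<longleftrightarrow>
    (\<forall>m>0. \<forall>x. distinct_points X m x \<longrightarrow>
       (SUP t\<in>X. ereal (mat_norm1 (the (mat_inverse (kernel_matrix d K m x)) * kernel_column d K m x t)))
         \<le> 1)"
  using linear_representer_imp_bound[OF assms(3)] bound_imp_linear_representer[OF assms(3)]
  \<comment> \<open>In the extended reals a supremum is at most 1 exactly when every term is, with
    no prior boundedness to check; this turns the right side into the pointwise bound.\<close>
  unfolding one_ereal_def SUP_le_iff ereal_less_eq by blast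

end
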